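(* Let $A\in\mathbb{R}^{n\times n}$ be such that $A-I$ is a nonsingular $M$-matrix and let $b\in\mathbb{R}^n$. Then any single-flip algorithm flipping a mismatched coordinate at each iteration solves the absolute value equation $Ax-|x|=b$ in at most $n$ iterations when the initial sign vector is $z=-\mathbf{1}$, and in at most $2n$ iterations for an arbitrary initial sign vector $z\in\{-1,1\}^n$.
   Context: A square matrix $B$ is a nonsingular $M$-matrix if $B=sI-C$ with $C\ge0$ entrywise and $s>\rho(C)$, where $\rho$ is the spectral radius. $\mathbf{1}$ is the all-ones vector, and $|x|$ is componentwise. For $z\in\{-1,1\}^n$ write $Z=\operatorname{Diag}(z)$; under the stated assumption $A-Z$ is nonsingular for all such $z$. Single-flip algorithm: initialize $z\in\{-1,1\}^n$; compute $x=(A-Z)^{-1}b$ and the mismatch set $\mathcal{V}_z=\{i\in\{1,\dots,n\}: z_ix_i<0\}$. While $\mathcal{V}_z\neq\emptyset$: select some index $j\in\mathcal{V}_z$ (by any rule); replace $z_j$ by $-z_j$; recompute $Z$, $x=(A-Z)^{-1}b$ and $\mathcal{V}_z$. When $\mathcal{V}_z=\emptyset$, return $x$. One pass through the while loop is one iteration. *)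

theory Defs
  imports
    "Jordan_Normal_Form.Gauss_Jordan_Elimination"
    "Jordan_Normal_Form.Spectral_Radius"
begin

definition nonsingular_M_matrix :: "real mat \<Rightarrow> bool" where
  "nonsingular_M_matrix B \<longleftrightarrow> square_mat B \<and>
     (\<exists>s C. C \<in> carrier_mat (dim_row B) (dim_row B) \<and>
        (\<forall>i < dim_row B. \<forall>j < dim_row B. 0 \<le> C $$ (i, j)) \<and>
        B = s \<cdot>\<^sub>m 1\<^sub>m (dim_row B) - C \<and>
        s > spectral_radius (map_mat complex_of_real C))"

definition solves_ave :: "real mat \<Rightarrow> real vec \<Rightarrow> real vec \<Rightarrow> bool" where
  "solves_ave A b x \<longleftrightarrow> x \<in> carrier_vec (dim_col A) \<and> A *\<^sub>v x - map_vec abs x = b"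

definition sign_vec :: "nat \<Rightarrow> real vec \<Rightarrow> bool" where
  "sign_vec n z \<longleftrightarrow> z \<in> carrier_vec n \<and> (\<forall>i < n. z $ i \<in> {-1, 1})"

definition Diag :: "real vec \<Rightarrow> real mat" where
  "Diag z = mat_diag (dim_vec z) (\<lambda>i. z $ i)"

text \<open>The vector below is \<open>(A - Z)\<^sup>-\<^sup>1 b\<close>; it is meaningful only if \<open>A - Z\<close> is invertible.\<close>

definition iterate :: "real mat \<Rightarrow> real vec \<Rightarrow> real vec \<Rightarrow> real vec" where
  "iterate A b z = the (mat_inverse (A - Diag z)) *\<^sub>v b"

definition mismatch :: "real mat \<Rightarrow> real vec \<Rightarrow> real vec \<Rightarrow> nat set" where
  "mismatch A b z = {i. i < dim_vec z \<and> z $ i * iterate A b z $ i < 0}"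

definition flip :: "real vec \<Rightarrow> nat \<Rightarrow> real vec" where
  "flip z j = vec (dim_vec z) (\<lambda>i. if i = j then - z $ i else z $ i)"

text \<open>
  One pass through the while loop.  The relation leaves the choice of the mismatched index
  open, so its chains are the executions under all selection rules, including
  history-dependent ones.  A state has no successor iff its mismatch set is empty, which is
  exactly when the algorithm returns.
\<close>

definition single_flip_step :: "real mat \<Rightarrow> real vec \<Rightarrow> real vec \<Rightarrow> real vec \<Rightarrow> bool" where
  "single_flip_step A b z z' \<longleftrightarrow> (\<exists>j \<in> mismatch A b z. z' = flip z j)"

text \<open>
  Every execution from \<open>z\<^sub>0\<close> performs at most \<open>N\<close> iterations (so it terminates), the inverses it
  uses all exist, and whatever it returns solves the equation.
\<close>

definition single_flip_solves_within ::
  "real mat \<Rightarrow> real vec \<Rightarrow> real vec \<Rightarrow> nat \<Rightarrow> bool" where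
  "single_flip_solves_within A b z\<^sub>0 N \<longleftrightarrow>
     (\<forall>k z. (single_flip_step A b ^^ k) z\<^sub>0 z \<longrightarrow>
        k \<le> N \<and> invertible_mat (A - Diag z) \<and>
        (mismatch A b z = {} \<longrightarrow> solves_ave A b (iterate A b z)))"

end

theory Submission
  imports Defs
begin

text \<open>
  The shift of a nonsingular M-matrix admits a positive vector with positive image (a truncated
  Neumann series applied to \<open>\<one>\<close>); the same vector works for every \<open>A - Z\<close>, so all these matrices
  are inverse-nonnegative. Flipping a mismatched \<open>z\<^sub>j\<close> turns \<open>B = A - Z\<close> into \<open>B'\<close> with
  \<open>B'(x' - x) = -2 z\<^sub>j x\<^sub>j e\<^sub>j \<ge> 0\<close>, whence \<open>x \<le> x'\<close>: the iterates increase, whatever the direction of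
  the flip. A coordinate flipped to \<open>1\<close> has \<open>x\<^sub>j > 0\<close> for ever after, so it is never flipped again,
  which bounds the number of flips per coordinate by one if it starts at \<open>-1\<close> and by two otherwise.
\<close>

section \<open>Inverse-nonnegative matrices\<close>

lemma index_mult_mat_vec_sum:
  assumes "B \<in> carrier_mat n n" "x \<in> carrier_vec n" "i < n"
  shows "(B *\<^sub>v x) $ i = (\<Sum>j<n. B $$ (i, j) * x $ j)"
  using assms by (auto simp: scalar_prod_def lessThan_atLeast0)

text \<open>\<open>P ^\<^sub>m Suc k\<close> unfolds with its new factor on the right, while the
  recursion for row sums below peels one off on the left.\<close>

lemma pow_mat_commute:
  assumes "P \<in> carrier_mat n n"
  shows "P * P ^\<^sub>m k = P ^\<^sub>m k * P"
proof (induction k)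
  case 0
  then show ?case using assms by simp
next
  case (Suc k)
  have "P * P ^\<^sub>m Suc k = (P * P ^\<^sub>m k) * P"
    using assms by (simp add: assoc_mult_mat[of _ n n _ n _ n])
  then show ?case using Suc by simp
qed

section \<open>From the spectral radius to a positive vector with positive image\<close>

lemma spectral_radius_nonneg:
  assumes "A \<in> carrier_mat n n" "n > 0"
  shows "0 \<le> spectral_radius A"
  using spectral_radius_mem_max(1)[OF assms] by auto

text \<open>Scaling by \<open>1 / t\<close> scales the eigenvalues, so the spectral radius drops
  below 1, and the Jordan normal form then bounds all powers by one constant.\<close>

lemma norm_bound_pow_of_spectral_radius_less:
  fixes C :: "real mat"
  assumes C: "C \<in> carrier_mat n n" and n: "n > 0" and t: "0 < t"
    and rad: "spectral_radius (map_mat complex_of_real C) < t"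
  shows "\<exists>c. \<forall>k. norm_bound (((1 / t) \<cdot>\<^sub>m C) ^\<^sub>m k) c"
proof -
  let ?P = "(1 / t) \<cdot>\<^sub>m C"
  let ?C' = "map_mat complex_of_real C" and ?P' = "map_mat complex_of_real ?P"
  have C': "?C' \<in> carrier_mat n n" and P: "?P \<in> carrier_mat n n"
    and P': "?P' \<in> carrier_mat n n" using C by auto
  have CP: "?C' = complex_of_real t \<cdot>\<^sub>m ?P'"
    using t by (auto intro!: eq_matI)
  \<comment> \<open>For an eigenvalue \<open>k\<close> of \<open>?P'\<close> of largest modulus,
    \<open>t * k\<close> is an eigenvalue of \<open>?C'\<close>, so
    \<open>t * norm k < t\<close>.\<close>
  have "spectral_radius ?P' \<in> norm ` spectrum ?P'"
    by (rule spectral_radius_mem_max(1)[OF P' n])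
  then obtain k v where k: "spectral_radius ?P' = norm k" and ev: "eigenvector ?P' v k"
    unfolding spectrum_def eigenvalue_def by auto
  have v: "v \<in> carrier_vec n" and Pv: "?P' *\<^sub>v v = k \<cdot>\<^sub>v v"
    using ev P' unfolding eigenvector_def by auto
  have "?C' *\<^sub>v v = complex_of_real t \<cdot>\<^sub>v (?P' *\<^sub>v v)"
    unfolding CP using P' v by (auto intro!: eq_vecI)
  then have "?C' *\<^sub>v v = (complex_of_real t * k) \<cdot>\<^sub>v v"
    unfolding Pv by (simp add: smult_smult_assoc)
  then have "eigenvector ?C' v (complex_of_real t * k)"
    using ev C unfolding eigenvector_def by simp
  then have "norm (complex_of_real t * k) \<in> norm ` spectrum ?C'"
    unfolding spectrum_def eigenvalue_def by blast
  from spectral_radius_mem_max(2)[OF C' n this] have "t * norm k \<le> spectral_radius ?C'"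
    using t by (simp add: norm_mult)
  then have "t * norm k < t * 1" using rad by simp
  then have "spectral_radius ?P' < 1" using t k by simp
  from spectral_radius_jnf_norm_bound_less_1_upper_triangular[OF P' this]
  obtain c where c: "\<And>m. norm_bound (?P' ^\<^sub>m m) c" by auto
  have "norm_bound (?P ^\<^sub>m m) c" for m
  proof -
    have eq: "?P' ^\<^sub>m m = map_mat complex_of_real (?P ^\<^sub>m m)"
      by (rule of_real_hom.mat_hom_pow[OF P, symmetric])
    show ?thesis using c[of m] unfolding eq norm_bound_def by auto
  qed
  then show ?thesis by blast
qed

text \<open>The witness v is the sum of (C/s)^k 1 over k < N. Telescoping gives C v = s (v - 1 +
  (C/s)^N 1), and the remainder (C/s)^N 1 is entrywise below 1 once N is large.\<close>

lemma semipositive_of_spectral_radius_less: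
  fixes C :: "real mat"
  assumes C: "C \<in> carrier_mat n n"
    and nonneg: "\<And>i j. i < n \<Longrightarrow> j < n \<Longrightarrow> 0 \<le> C $$ (i, j)"
    and rad: "spectral_radius (map_mat complex_of_real C) < s"
  shows "\<exists>v. \<forall>i<n. 0 < v i \<and> (\<Sum>j<n. C $$ (i, j) * v j) < s * v i"
\<comment> \<open>The spectral radius is a maximum over the spectrum, which is empty in dimension
  0.\<close>
proof (cases "n = 0")
  case True
  then show ?thesis by simp
next
  case False
  then have n: "n > 0" by simp
  have "0 \<le> spectral_radius (map_mat complex_of_real C)"
    by (rule spectral_radius_nonneg[OF _ n]) (use C in auto)
  \<comment> \<open>Splitting the gap at \<open>t\<close> keeps the powers of C/t bounded, so those
    of C/s decay like \<open>q ^ N\<close>.\<close>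
  moreover obtain t where "spectral_radius (map_mat complex_of_real C) < t" "t < s"
    using dense[OF rad] by blast
  ultimately have t: "spectral_radius (map_mat complex_of_real C) < t" "0 < t" "t < s" by simp_all
  define q where "q = t / s"
  have q: "0 < q" "q < 1" "q * s = t" using t by (auto simp: q_def)
  define P where "P = (1 / t) \<cdot>\<^sub>m C"
  have P: "P \<in> carrier_mat n n" using C by (simp add: P_def)
  obtain c where c: "\<And>k. norm_bound (P ^\<^sub>m k) c"
    using norm_bound_pow_of_spectral_radius_less[OF C n t(2) t(1)] unfolding P_def by blast
  \<comment> \<open>\<open>w k\<close> is P^k 1, so \<open>q ^ k * w k i\<close> is entry
    \<open>i\<close> of (C/s)^k 1.\<close>
  define w where "w k i = (\<Sum>j<n. (P ^\<^sub>m k) $$ (i, j))" for k i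
  have w0: "w 0 i = 1" if "i < n" for i
    using that P by (simp add: w_def)
  have wS: "(\<Sum>j<n. C $$ (i, j) * w k j) = t * w (Suc k) i" if i: "i < n" for k i
  proof -
    have Pk: "P ^\<^sub>m k \<in> carrier_mat n n" using P by simp
    have "w (Suc k) i = (\<Sum>l<n. (P * P ^\<^sub>m k) $$ (i, l))"
      using pow_mat_commute[OF P] by (simp add: w_def)
    also have "\<dots> = (\<Sum>l<n. \<Sum>j<n. P $$ (i, j) * (P ^\<^sub>m k) $$ (j, l))"
      using P Pk i by (intro sum.cong refl) (auto simp: scalar_prod_def lessThan_atLeast0)
    also have "\<dots> = (\<Sum>j<n. P $$ (i, j) * w k j)"
      unfolding w_def sum_distrib_left by (rule sum.swap)
    finally have "t * w (Suc k) i = (\<Sum>j<n. t * (P $$ (i, j) * w k j))"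
      by (simp add: sum_distrib_left)
    also have "\<dots> = (\<Sum>j<n. C $$ (i, j) * w k j)"
      using C i t by (intro sum.cong refl) (auto simp: P_def)
    finally show ?thesis by simp
  qed
  have w_nonneg: "0 \<le> w k i" if "i < n" for k i
    using that
  proof (induction k arbitrary: i)
    case 0
    then show ?case by (simp add: w0)
  next
    case (Suc k)
    have "0 \<le> t * w (Suc k) i"
      unfolding wS[OF Suc.prems, symmetric] using Suc nonneg by (auto intro!: sum_nonneg)
    then show ?case using t by (simp add: zero_le_mult_iff)
  qed
  have w_le: "w k i \<le> real n * c" if "i < n" for k i
  proof -
    have "w k i \<le> (\<Sum>j<n. c)"
      unfolding w_def
    proof (rule sum_mono)
      fix j assume "j \<in> {..<n}"
      then have "norm ((P ^\<^sub>m k) $$ (i, j)) \<le> c"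
        using c[of k] P that unfolding norm_bound_def by simp
      then show "(P ^\<^sub>m k) $$ (i, j) \<le> c" by simp
    qed
    then show ?thesis by simp
  qed
  have "(\<lambda>N. q ^ N * (real n * c)) \<longlonglongrightarrow> 0 * (real n * c)"
    using q by (intro tendsto_mult tendsto_const LIMSEQ_realpow_zero) auto
  then have "eventually (\<lambda>N. q ^ N * (real n * c) < 1) sequentially"
    by (intro order_tendstoD(2)) auto
  then obtain N0 where N0: "\<And>N. N \<ge> N0 \<Longrightarrow> q ^ N * (real n * c) < 1"
    unfolding eventually_sequentially by blast
  \<comment> \<open>The successor makes \<open>N\<close> positive, so that \<open>v\<close> contains
    the term for k = 0, which is 1.\<close>
  define N where "N = Suc N0"
  have N: "q ^ N * (real n * c) < 1" using N0[of N] by (simp add: N_def)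
  define v where "v i = (\<Sum>k<N. q ^ k * w k i)" for i
  have "0 < v i \<and> (\<Sum>j<n. C $$ (i, j) * v j) < s * v i" if i: "i < n" for i
  proof
    have "0 < q ^ 0 * w 0 i" using w0[OF i] by simp
    also have "\<dots> \<le> v i"
      unfolding v_def using w_nonneg[OF i] q by (intro member_le_sum) (auto simp: N_def)
    finally show "0 < v i" .
    have "(\<Sum>j<n. C $$ (i, j) * v j) = (\<Sum>k<N. \<Sum>j<n. q ^ k * (C $$ (i, j) * w k j))"
      unfolding v_def sum_distrib_left
      by (subst sum.swap) (simp add: mult_ac)
    also have "\<dots> = (\<Sum>k<N. q ^ k * (t * w (Suc k) i))"
      by (simp add: sum_distrib_left[symmetric] wS[OF i])
    also have "\<dots> = s * (\<Sum>k<N. q ^ Suc k * w (Suc k) i)"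
      unfolding sum_distrib_left q(3)[symmetric] by (simp add: mult_ac)
    \<comment> \<open>The index shift drops the term for k = 0 and brings in the remainder for k =
      N.\<close>
    also have "(\<Sum>k<N. q ^ Suc k * w (Suc k) i) = v i - w 0 i + q ^ N * w N i"
      unfolding v_def using sum.lessThan_Suc_shift[of "\<lambda>k. q ^ k * w k i" N] by simp
    also have "s * (v i - w 0 i + q ^ N * w N i) < s * v i"
    proof -
      have "q ^ N * w N i \<le> q ^ N * (real n * c)"
        using w_le[OF i] q by (intro mult_left_mono) auto
      then show ?thesis using N w0[OF i] t by simp
    qed
    finally show "(\<Sum>j<n. C $$ (i, j) * v j) < s * v i" .
  qed
  then show ?thesis by blast
qed

section \<open>Monotone matrices\<close>

text \<open>Monotonicity in the sense of Collatz: for square matrices it amounts to having an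
  entrywise nonnegative inverse, but it presupposes no inverse.\<close>

definition monotone_mat :: "real mat \<Rightarrow> bool" where
  "monotone_mat B \<longleftrightarrow> (\<forall>x \<in> carrier_vec (dim_col B).
     (\<forall>i < dim_row B. 0 \<le> (B *\<^sub>v x) $ i) \<longrightarrow> (\<forall>i < dim_col B. 0 \<le> x $ i))"

lemma monotone_matD:
  assumes "monotone_mat B" "B \<in> carrier_mat n n" "x \<in> carrier_vec n"
    and "\<And>i. i < n \<Longrightarrow> 0 \<le> (B *\<^sub>v x) $ i" and "i < n"
  shows "0 \<le> x $ i"
  using assms unfolding monotone_mat_def by auto

text \<open>Let r = x_m / v_m be the least ratio and suppose r < 0. Then x - r v is nonnegative and
  vanishes at m, so row m of B (x - r v) is at most 0 by the signs off the diagonal; yet (B x)_m - r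
  (B v)_m > 0.\<close>

lemma monotone_mat_of_semipositive:
  assumes B: "B \<in> carrier_mat n n"
    and off: "\<And>i j. i < n \<Longrightarrow> j < n \<Longrightarrow> i \<noteq> j \<Longrightarrow> B $$ (i, j) \<le> 0"
    and v: "\<And>i. i < n \<Longrightarrow> 0 < v i"
    and Bv: "\<And>i. i < n \<Longrightarrow> 0 < (\<Sum>j<n. B $$ (i, j) * v j)"
  shows "monotone_mat B"
proof -
  have "0 \<le> x $ i" if x: "x \<in> carrier_vec n" and Bx: "\<And>i. i < n \<Longrightarrow> 0 \<le> (B *\<^sub>v x) $ i"
    and i: "i < n" for x i
  proof (rule ccontr)
    assume neg: "\<not> 0 \<le> x $ i"
    define m where "m = arg_min_on (\<lambda>j. x $ j / v j) {..<n}"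
    have m: "m < n"
      using arg_min_if_finite(1)[of "{..<n}" "\<lambda>j. x $ j / v j"] i unfolding m_def by auto
    define r where "r = x $ m / v m"
    have r_le: "r \<le> x $ j / v j" if "j < n" for j
      unfolding r_def m_def using arg_min_least[of "{..<n}" j "\<lambda>j. x $ j / v j"] that by auto
    have "x $ i / v i < 0" using neg v[OF i] by (simp add: divide_neg_pos)
    with r_le[OF i] have r: "r < 0" by simp
    have "(\<Sum>j<n. B $$ (m, j) * (x $ j - r * v j)) \<le> 0"
    proof (rule sum_nonpos)
      fix j assume "j \<in> {..<n}"
      then have j: "j < n" by simp
      show "B $$ (m, j) * (x $ j - r * v j) \<le> 0"
      proof (cases "j = m")
        case True
        then show ?thesis using v[OF m] by (simp add: r_def)
      next
        case False
        have "r * v j \<le> x $ j" using r_le[OF j] v[OF j] by (simp add: field_simps)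
        then show ?thesis using off[OF m j] False by (simp add: mult_nonpos_nonneg)
      qed
    qed
    moreover have "(\<Sum>j<n. B $$ (m, j) * (x $ j - r * v j))
        = (B *\<^sub>v x) $ m - r * (\<Sum>j<n. B $$ (m, j) * v j)"
      unfolding index_mult_mat_vec_sum[OF B x m]
      by (simp add: right_diff_distrib sum_subtractf sum_distrib_left mult_ac)
    moreover have "r * (\<Sum>j<n. B $$ (m, j) * v j) < 0" using r Bv[OF m] by (rule mult_neg_pos)
    ultimately show False using Bx[OF m] by simp
  qed
  then show ?thesis using B unfolding monotone_mat_def by auto
qed

text \<open>If x is in the kernel, then x and -x both have nonnegative image, so both are
  nonnegative and x = 0.\<close>

lemma monotone_mat_inverse:
  assumes B: "B \<in> carrier_mat n n" and mono: "monotone_mat B"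
  shows "\<exists>X. mat_inverse B = Some X \<and> X \<in> carrier_mat n n \<and> B * X = 1\<^sub>m n \<and> X * B = 1\<^sub>m n"
proof -
  have "det B \<noteq> 0"
  proof
    assume "det B = 0"
    then obtain x where x: "x \<in> carrier_vec n" "x \<noteq> 0\<^sub>v n" "B *\<^sub>v x = 0\<^sub>v n"
      using det_0_iff_vec_prod_zero_field[OF B] by auto
    have mx: "B *\<^sub>v (- x) = 0\<^sub>v n"
      using B x index_mult_mat_vec_sum[OF B, of "- x"] index_mult_mat_vec_sum[OF B x(1)]
      by (intro eq_vecI) (auto simp: sum_negf)
    have "x $ i = 0" if "i < n" for i
    proof -
      have "0 \<le> x $ i" by (rule monotone_matD[OF mono B x(1) _ that]) (simp add: x)
      moreover have "0 \<le> (- x) $ i"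
        by (rule monotone_matD[OF mono B _ _ that]) (use mx x in auto)
      ultimately show ?thesis using x that by simp
    qed
    then show False using x by (auto intro!: eq_vecI)
  qed
  then have "B \<in> Units (ring_mat TYPE(real) n ())" by (rule det_non_zero_imp_unit[OF B])
  then show ?thesis using mat_inverse(1)[OF B, where b = "()"] mat_inverse(2)[OF B] by (cases "mat_inverse B") auto
qed

section \<open>The single-flip iteration\<close>

lemma Diag_carrier [simp]: "z \<in> carrier_vec n \<Longrightarrow> Diag z \<in> carrier_mat n n"
  by (auto simp: Diag_def)

lemma sign_vecD:
  assumes "sign_vec n z"
  shows "z \<in> carrier_vec n" "dim_vec z = n" "i < n \<Longrightarrow> z $ i = -1 \<or> z $ i = 1"
  using assms by (auto simp: sign_vec_def)

lemma sign_vec_flip: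
  assumes "sign_vec n z"
  shows "sign_vec n (flip z j)"
proof -
  have "flip z j $ i \<in> {-1, 1}" if "i < n" for i
    using sign_vecD(3)[OF assms that] sign_vecD(2)[OF assms] that by (simp add: flip_def) force
  then show ?thesis using sign_vecD(2)[OF assms] by (simp add: sign_vec_def flip_def)
qed

lemma minus_Diag_mult_vec:
  assumes A: "A \<in> carrier_mat n n" and z: "z \<in> carrier_vec n" and x: "x \<in> carrier_vec n"
    and i: "i < n"
  shows "((A - Diag z) *\<^sub>v x) $ i = (A *\<^sub>v x) $ i - z $ i * x $ i"
proof -
  have "A - Diag z \<in> carrier_mat n n" using z by (intro minus_carrier_mat) simp
  then have "((A - Diag z) *\<^sub>v x) $ i = (\<Sum>j<n. (A $$ (i, j) - (if i = j then z $ j else 0)) * x $ j)"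
    using A z i by (simp add: index_mult_mat_vec_sum[OF _ x i])
      (auto intro!: sum.cong simp: Diag_def mat_diag_def)
  also have "\<dots> = (A *\<^sub>v x) $ i - (\<Sum>j<n. if i = j then z $ j * x $ j else 0)"
    unfolding index_mult_mat_vec_sum[OF A x i] sum_subtractf[symmetric]
    by (intro sum.cong) (auto simp: algebra_simps)
  finally show ?thesis using i by simp
qed

text \<open>A - Z is (s + 1) I - Z - C with z_i \<le> 1, so (A - Z) v \<ge> s v - C v > 0 for one v
  that serves all z.\<close>

lemma monotone_mat_minus_Diag:
  assumes A: "A \<in> carrier_mat n n" and M: "nonsingular_M_matrix (A - 1\<^sub>m n)"
    and z: "sign_vec n z"
  shows "monotone_mat (A - Diag z)"
proof -
  have dim: "dim_row (A - 1\<^sub>m n) = n" by simp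
  obtain s C where C: "C \<in> carrier_mat n n"
    and nonneg: "\<And>i j. i < n \<Longrightarrow> j < n \<Longrightarrow> 0 \<le> C $$ (i, j)"
    and eq: "A - 1\<^sub>m n = s \<cdot>\<^sub>m 1\<^sub>m n - C"
    and rad: "spectral_radius (map_mat complex_of_real C) < s"
    using M unfolding nonsingular_M_matrix_def dim by auto
  have entry: "(A - Diag z) $$ (i, j) = (if i = j then s + 1 - z $ i else 0) - C $$ (i, j)"
    if "i < n" "j < n" for i j
  proof -
    have "(A - 1\<^sub>m n) $$ (i, j) = (s \<cdot>\<^sub>m 1\<^sub>m n - C) $$ (i, j)" by (simp only: eq)
    then show ?thesis
      using that A C sign_vecD(2)[OF z] by (auto simp: Diag_def mat_diag_def split: if_splits)
  qed
  obtain v where v: "\<And>i. i < n \<Longrightarrow> 0 < v i"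
    and Cv: "\<And>i. i < n \<Longrightarrow> (\<Sum>j<n. C $$ (i, j) * v j) < s * v i"
    using semipositive_of_spectral_radius_less[OF C nonneg rad] by blast
  show ?thesis
  proof (rule monotone_mat_of_semipositive[where v = v])
    show "A - Diag z \<in> carrier_mat n n" using sign_vecD(1)[OF z] by (intro minus_carrier_mat) simp
    show "0 < v i" if "i < n" for i using v that .
    show "(A - Diag z) $$ (i, j) \<le> 0" if "i < n" "j < n" "i \<noteq> j" for i j
      using that entry nonneg by simp
    show "0 < (\<Sum>j<n. (A - Diag z) $$ (i, j) * v j)" if i: "i < n" for i
    proof -
      have "(\<Sum>j<n. (A - Diag z) $$ (i, j) * v j)
          = (\<Sum>j<n. if i = j then (s + 1 - z $ i) * v j else 0) - (\<Sum>j<n. C $$ (i, j) * v j)"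
        unfolding sum_subtractf[symmetric]
        using i entry by (intro sum.cong) (auto simp: left_diff_distrib)
      also have "\<dots> = (s + 1 - z $ i) * v i - (\<Sum>j<n. C $$ (i, j) * v j)" using i by simp
      also have "\<dots> > 0"
        using Cv[OF i] v[OF i] sign_vecD(3)[OF z i] by (auto simp: algebra_simps)
      finally show ?thesis .
    qed
  qed
qed

text \<open>
  The potential bounds the number of flips still possible: a coordinate at \<open>1\<close> with a negative
  iterate may be flipped twice, one at \<open>-1\<close> once, any other one never.
\<close>

definition flip_potential :: "real vec \<Rightarrow> real vec \<Rightarrow> nat" where
  "flip_potential z x =
     (\<Sum>i<dim_vec z. if z $ i < 0 then 1 else if x $ i < 0 then 2 else 0)"

lemma flip_potential_le: "flip_potential z x \<le> 2 * dim_vec z"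
proof -
  have "flip_potential z x \<le> (\<Sum>i<dim_vec z. 2)"
    unfolding flip_potential_def by (rule sum_mono) auto
  then show ?thesis by simp
qed

section \<open>Correctness and iteration count\<close>

context
  fixes A :: "real mat" and b :: "real vec" and n :: nat
  assumes A: "A \<in> carrier_mat n n" and b: "b \<in> carrier_vec n"
    and M: "nonsingular_M_matrix (A - 1\<^sub>m n)"
begin

text \<open>Monotonicity provides the inverse, so the \<open>the\<close> in \<open>iterate\<close>
  is applied to a genuine \<open>Some\<close>.\<close>

lemma iterate_correct:
  assumes z: "sign_vec n z"
  shows "invertible_mat (A - Diag z)" "iterate A b z \<in> carrier_vec n"
    "(A - Diag z) *\<^sub>v iterate A b z = b"
proof -
  have B: "A - Diag z \<in> carrier_mat n n"
    using sign_vecD(1)[OF z] by (intro minus_carrier_mat) simp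
  obtain X where X: "mat_inverse (A - Diag z) = Some X" "X \<in> carrier_mat n n"
    "(A - Diag z) * X = 1\<^sub>m n" "X * (A - Diag z) = 1\<^sub>m n"
    using monotone_mat_inverse[OF B monotone_mat_minus_Diag[OF A M z]] by blast
  show "invertible_mat (A - Diag z)"
    unfolding invertible_mat_def inverts_mat_def square_mat.simps
    using B X carrier_matD[OF B] carrier_matD[OF X(2)] by auto
  show "iterate A b z \<in> carrier_vec n" using X b by (simp add: iterate_def)
  show "(A - Diag z) *\<^sub>v iterate A b z = b"
    using X b B by (simp add: iterate_def assoc_mult_mat_vec[symmetric])
qed

text \<open>B'(x' - x) = b - B'x = (B - B')x = (Z' - Z)x, whose only nonzero entry is -2 z_j x_j >
  0; now B' is monotone.\<close>

lemma iterate_flip_mono: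
  assumes z: "sign_vec n z" and j: "j \<in> mismatch A b z" and i: "i < n"
  shows "iterate A b z $ i \<le> iterate A b (flip z j) $ i"
proof -
  let ?z' = "flip z j"
  let ?x = "iterate A b z" and ?x' = "iterate A b (flip z j)"
  let ?B = "A - Diag z" and ?B' = "A - Diag (flip z j)"
  have z': "sign_vec n ?z'" using sign_vec_flip[OF z] .
  note x = iterate_correct(2,3)[OF z] and x' = iterate_correct(2,3)[OF z']
  have B': "?B' \<in> carrier_mat n n"
    using sign_vecD(1)[OF z'] by (intro minus_carrier_mat) simp
  have "0 \<le> (?x' - ?x) $ i"
  proof (rule monotone_matD[OF monotone_mat_minus_Diag[OF A M z'] B' _ _ i])
    show "?x' - ?x \<in> carrier_vec n" using x x' by simp
    fix l assume l: "l < n"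
    have "(?B' *\<^sub>v (?x' - ?x)) $ l = b $ l - (?B' *\<^sub>v ?x) $ l"
      using carrier_matD(1)[OF B'] x x' l by (simp del: index_mult_mat_vec add: mult_minus_distrib_mat_vec[OF B' x'(1) x(1)])
    also have "\<dots> = (?B *\<^sub>v ?x) $ l - (?B' *\<^sub>v ?x) $ l" using x by simp
    also have "\<dots> = (?z' $ l - z $ l) * ?x $ l"
      using minus_Diag_mult_vec[OF A sign_vecD(1)[OF z] x(1) l]
        minus_Diag_mult_vec[OF A sign_vecD(1)[OF z'] x(1) l]
      by (simp add: algebra_simps)
    also have "\<dots> \<ge> 0"
      using j l sign_vecD(2)[OF z] by (auto simp: flip_def mismatch_def)
    finally show "0 \<le> (?B' *\<^sub>v (?x' - ?x)) $ l" .
  qed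
  then show ?thesis using x x' i by simp
qed

text \<open>Away from \<open>j\<close> the sign is kept and the iterate can only grow, so no summand
  increases; the summand at \<open>j\<close> drops by one.\<close>

lemma flip_potential_decreasing:
  assumes z: "sign_vec n z" and j: "j \<in> mismatch A b z"
  shows "flip_potential (flip z j) (iterate A b (flip z j)) < flip_potential z (iterate A b z)"
proof -
  have dim: "dim_vec z = n" "dim_vec (flip z j) = n"
    using sign_vecD(2)[OF z] by (auto simp: flip_def)
  have jn: "j < n" and neg: "z $ j * iterate A b z $ j < 0"
    using j dim by (auto simp: mismatch_def)
  note mono = iterate_flip_mono[OF z j]
  show ?thesis
    unfolding flip_potential_def dim
  proof (rule sum_strict_mono_ex1)
    show "finite {..<n}" by simp
    have flipped: "(if flip z j $ j < 0 then 1 else if iterate A b (flip z j) $ j < 0 then 2 else 0)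
      < (if z $ j < 0 then 1 else if iterate A b z $ j < 0 then 2 else (0::nat))"
    proof (cases "z $ j = 1")
      case True
      then show ?thesis using jn neg dim by (simp add: flip_def)
    next
      case False
      then have "z $ j = -1" using sign_vecD(3)[OF z jn] by simp
      \<comment> \<open>A mismatch at -1 means x_j > 0, which persists after the flip: the summand
        falls from 1 to 0.\<close>
      then show ?thesis using jn neg mono[OF jn] dim by (simp add: flip_def)
    qed
    show "\<forall>i\<in>{..<n}.
      (if flip z j $ i < 0 then 1 else if iterate A b (flip z j) $ i < 0 then 2 else 0)
      \<le> (if z $ i < 0 then 1 else if iterate A b z $ i < 0 then 2 else (0::nat))"
    proof
      fix i assume "i \<in> {..<n}"
      then show "(if flip z j $ i < 0 then 1 else if iterate A b (flip z j) $ i < 0 then 2 else 0)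
        \<le> (if z $ i < 0 then 1 else if iterate A b z $ i < 0 then 2 else (0::nat))"
        using flipped mono[of i] dim
        by (cases "i = j") (simp only: less_imp_le, auto simp: flip_def)
    qed
    show "\<exists>i\<in>{..<n}.
      (if flip z j $ i < 0 then 1 else if iterate A b (flip z j) $ i < 0 then 2 else 0)
      < (if z $ i < 0 then 1 else if iterate A b z $ i < 0 then 2 else (0::nat))"
      using flipped jn by blast
  qed
qed

text \<open>Every iteration uses up at least one unit of potential. The sign property is carried
  along because the decrease applies to sign vectors.\<close>

lemma single_flip_chain:
  assumes "sign_vec n z" and "(single_flip_step A b ^^ k) z z'"
  shows "sign_vec n z' \<and>
    k + flip_potential z' (iterate A b z') \<le> flip_potential z (iterate A b z)"
  using assms(2)
proof (induction k arbitrary: z')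
  case 0
  then show ?case using assms(1) by simp
next
  case (Suc k)
  then obtain y where y: "(single_flip_step A b ^^ k) z y" "single_flip_step A b y z'" by auto
  then obtain j where j: "j \<in> mismatch A b y" "z' = flip y j"
    unfolding single_flip_step_def by blast
  show ?case
    using Suc.IH[OF y(1)] flip_potential_decreasing[of y j] j sign_vec_flip[of n y j] by auto
qed

text \<open>Without mismatches z_i x_i = |x_i| for all i, so Z x = |x| and (A - Z) x = b becomes the
  equation sought.\<close>

lemma solves_ave_iterate:
  assumes z: "sign_vec n z" and "mismatch A b z = {}"
  shows "solves_ave A b (iterate A b z)"
proof -
  note x = iterate_correct(2,3)[OF z]
  have "A *\<^sub>v iterate A b z - map_vec abs (iterate A b z) = b"
  proof (rule eq_vecI)
    fix i assume "i < dim_vec b"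
    then have i: "i < n" using b by simp
    have "\<not> z $ i * iterate A b z $ i < 0"
      using assms(2) i sign_vecD(2)[OF z] by (auto simp: mismatch_def)
    then have "z $ i * iterate A b z $ i = \<bar>iterate A b z $ i\<bar>"
      using sign_vecD(3)[OF z i] by auto
    then show "(A *\<^sub>v iterate A b z - map_vec abs (iterate A b z)) $ i = b $ i"
      using minus_Diag_mult_vec[OF A sign_vecD(1)[OF z] x(1) i] x i by simp
  qed (use x b in auto)
  then show ?thesis using A x by (simp add: solves_ave_def)
qed

lemma single_flip_solves_within_flip_potential:
  assumes "sign_vec n z" and "flip_potential z (iterate A b z) \<le> N"
  shows "single_flip_solves_within A b z N"
  unfolding single_flip_solves_within_def
proof (intro allI impI conjI)
  fix k z' assume "(single_flip_step A b ^^ k) z z'"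
  note chain = single_flip_chain[OF assms(1) this]
  show "k \<le> N" using chain assms(2) by linarith
  show "invertible_mat (A - Diag z')" using chain iterate_correct(1) by blast
  show "solves_ave A b (iterate A b z')" if "mismatch A b z' = {}"
    using chain solves_ave_iterate that by blast
qed

end

theorem theorem3p17:
  fixes A :: "real mat" and b :: "real vec" and n :: nat
  assumes "A \<in> carrier_mat n n"
    and "b \<in> carrier_vec n"
    and "nonsingular_M_matrix (A - 1\<^sub>m n)"
  shows "single_flip_solves_within A b (vec n (\<lambda>_. -1)) n \<and>
    (\<forall>z. sign_vec n z \<longrightarrow> single_flip_solves_within A b z (2 * n))"
proof (intro conjI allI impI)
  \<comment> \<open>At the start every coordinate is -1 and contributes 1, so the potential is
    \<open>n\<close>.\<close>
  show "single_flip_solves_within A b (vec n (\<lambda>_. -1)) n"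
    by (rule single_flip_solves_within_flip_potential[OF assms])
      (auto simp: sign_vec_def flip_potential_def)
next
  fix z assume z: "sign_vec n z"
  \<comment> \<open>Each coordinate contributes at most 2 to the initial potential.\<close>
  show "single_flip_solves_within A b z (2 * n)"
    using single_flip_solves_within_flip_potential[OF assms z]
      flip_potential_le[of z] sign_vecD(2)[OF z] by simp
qed

end
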